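(* Let $c,c'$ be GCL commands and $f,f'$ labels with $\mathrm{okf}(c,f)$ and $\mathrm{okf}(c',f')$. Let $L,R,J$ be live alignment conditions for $\mathrm{aut}(c,f),\mathrm{aut}(c',f')$, and let $an$ be a valid annotation of the alignment automaton $\prod(\mathrm{aut}(c,f),\mathrm{aut}(c',f'),L,R,J)$ for $\{\mathcal{S}\}\{\mathcal{T}\}$ such that $\breve{an}(i,j)\subseteq L\cup R\cup J\cup[f|f']$ for every control point $(i,j)$ of the product. Then the judgment $c\mid c':\langle\mathcal{S}\Rightarrow\mathcal{T}\rangle$ has a proof in RHL+.
   Context: Stores: total functions $\mathit{Var}\to\mathbb{Z}$. GCL commands $c::=\mathsf{skip}^n\mid x:=^n e\mid\mathsf{havoc}^n x\mid c;c\mid\mathsf{if}^n gcs\,\mathsf{fi}\mid\mathsf{do}^n gcs\,\mathsf{od}$, labels $n\in\mathbb{Z}$, $gcs$ nonempty lists of guarded commands $e\to c$, guards built from primitive boolean expressions $bprim$ by $\wedge,\vee,\neg$, $\mathrm{enab}(gcs)$ the disjunction of guards; commands well typed with each $\mathsf{if}\,gcs\,\mathsf{fi}$ having $\mathrm{enab}(gcs)$ valid. $\mathrm{labs}(c)$: labels of $c$; $\mathrm{lab}(c)$: label of $c$, $\mathrm{lab}(c;d)=\mathrm{lab}(c)$; $\mathrm{okf}(c,f)$: labels of $c$ positive, pairwise distinct, $f\notin\mathrm{labs}(c)$; $\mathrm{sub}(n,c)$: subcommand of $c$ not of the form $d;d'$ with label $n$. Small-step semantics: $\langle\mathsf{havoc}^n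 x,s\rangle\rightsquigarrow\langle\mathsf{skip}^{-n},s[x\mapsto v]\rangle$; $\langle x:=^n e,s\rangle\rightsquigarrow\langle\mathsf{skip}^{-n},s[x\mapsto\llbracket e\rrbracket(s)]\rangle$; $\langle\mathsf{skip}^n;c,s\rangle\rightsquigarrow\langle c,s\rangle$; $\langle\mathsf{if}^n gcs\,\mathsf{fi},s\rangle\rightsquigarrow\langle c,s\rangle$ for $e\to c\in gcs$ with $e$ true in $s$; $\langle\mathsf{do}^n gcs\,\mathsf{od},s\rangle\rightsquigarrow\langle c;\mathsf{do}^n gcs\,\mathsf{od},s\rangle$ for $e\to c\in gcs$ with $e$ true; $\langle\mathsf{do}^n gcs\,\mathsf{od},s\rangle\rightsquigarrow\langle\mathsf{skip}^{-n},s\rangle$ if $\mathrm{enab}(gcs)$ false; $\langle c;b,s\rangle\rightsquigarrow\langle d;b,t\rangle$ if $\langle c,s\rangle\rightsquigarrow\langle d,t\rangle$. $\mathrm{fsuc}(n,c;d,f)=\mathrm{fsuc}(n,c,\mathrm{lab}(d))$ if $n\in\mathrm{labs}(c)$, else $\mathrm{fsuc}(n,d,f)$; $\mathrm{fsuc}(n,c,f)=f$ when $c$ is an if, do, skip, assignment or havoc with label $n$; $\mathrm{fsuc}(m,\mathsf{if}^n gcs\,\mathsf{fi},f)=\mathrm{fsuc}(m,c,f)$ and $\mathrm{fsuc}(m,\mathsf{do}^n gcs\,\mathsf{od},f)=\mathrm{fsuc}(m,c,n)$ for $e\to c\in gcs$, $m\in\mathrm{labs}(c)$. $\mathrm{aut}(c,f)$: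 control points $\mathrm{labs}(c)\cup\{f\}$, stores $\mathit{Var}\to\mathbb{Z}$, initial $\mathrm{lab}(c)$, final $f$, $(n,s)\to(m,t)$ iff (i) $\langle\mathrm{sub}(n,c),s\rangle\rightsquigarrow\langle d,t\rangle$, $\mathrm{lab}(d)>0$, $m=\mathrm{lab}(d)$; or (ii) $\langle\mathrm{sub}(n,c),s\rangle\rightsquigarrow\langle d,t\rangle$, $\mathrm{lab}(d)<0$, $m=\mathrm{fsuc}(n,c,f)$; or (iii) $\mathrm{sub}(n,c)=\mathsf{skip}^n$, $m=\mathrm{fsuc}(n,c,f)$, $t=s$. For automata $A$ (transitions $\to$) and $A'$ (transitions $\to'$) with control sets $Ctrl,Ctrl'$ and stores $Sto,Sto'$: $L,R,J\subseteq(Ctrl\times Ctrl')\times(Sto\times Sto')$ are live if states in $L$ have a left successor, in $R$ a right successor, in $J$ both; $\prod(A,A',L,R,J)$ has control points $Ctrl\times Ctrl'$, stores $Sto\times Sto'$, initial/final pairs of initial/final controls, and $((n,n'),(s,s'))\Rightarrow((m,m'),(t,t'))$ iff (LO) source in $L$, $(n,s)\to(m,t)$, $(n',s')=(m',t')$; (RO) source in $R$, $(n,s)=(m,t)$, $(n',s')\to'(m',t')$; or (JO) source in $J$, both step. An annotation of the product for $\{\mathcal{S}\}\{\mathcal{T}\}$ is a map $an$ from product control points to store relations with $an(\mathrm{lab}(c),\mathrm{lab}(c'))=\mathcal{S}$, $an(f,f')=\mathcal{T}$; valid if $(s,s')\in an(n,n')$ and $((n,n'),(s,s'))\Rightarrow((m,m'),(t,t'))$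 imply $(t,t')\in an(m,m')$. $\breve{an}(n,n')=\{((n,n'),(s,s'))\mid(s,s')\in an(n,n')\}$; $[f|f']$ is the set of product states with control $(f,f')$. RHL+: relations as in the following. $\langle P]=\{(s,s')\mid s\in P\}$, $[P\rangle=\{(s,s')\mid s'\in P\}$, a boolean expression denoting the stores where it is true; $\langle e|=|e'\rangle=\{(s,s')\mid\llbracket e\rrbracket(s)=\llbracket e'\rrbracket(s')\}$; $\mathcal{R}[x|:=e|]=\{(s,s')\mid(s[x\mapsto\llbracket e\rrbracket(s)],s')\in\mathcal{R}\}$, $\mathcal{R}[|x:=|e]$ symmetric; $(\forall x|.\mathcal{P})=\{(s,s')\mid\forall v.(s[x\mapsto v],s')\in\mathcal{P}\}$, $(\forall|x.\mathcal{P})$ symmetric; $\mathrm{indep}(x|x',\mathcal{R})$: $\mathcal{R}=\{(s,s')\mid\exists v,v'.(s[x\mapsto v],s'[x'\mapsto v'])\in\mathcal{R}\}$; $\mathrm{ghost}(x,c)$: $x$ occurs in $c$ only as target of assignments to $x$ and of $\mathsf{havoc}\,x$; $\mathrm{erase}(x,c)$ replaces these by $\mathsf{skip}$. $c\simeq d$ means $\mathrm{Hyp}\vdash\lfloor c\rfloor=\lfloor d\rfloor$ where $\lfloor\cdot\rfloor$ translates to KAT expressions ($\lfloor\mathsf{skip}\rfloor=1$; assignments, havocs, primitive boolean expressions to primitive symbols; $\wedge,\vee,\neg$ to $;,+,\neg$; $\lfloor c;d\rfloor=\lfloor c\rfloor;\lfloor d\rfloor$; $\lfloor\mathsf{if}\,gcs\,\mathsf{fi}\rfloor=\lfloor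 gcs\rfloor=\sum_{e\to c\in gcs}\lfloor e\rfloor;\lfloor c\rfloor$; $\lfloor\mathsf{do}\,gcs\,\mathsf{od}\rfloor=\lfloor gcs\rfloor^*;\neg\lfloor\mathrm{enab}(gcs)\rfloor$), $\vdash$ is equational and propositional reasoning from the KAT axioms (idempotent semiring, Boolean algebra of tests, $1+x;x^*=x^*$, $1+x^*;x=x^*$, $y+x;z\le z\Rightarrow x^*;y\le z$, $y+z;x\le z\Rightarrow y;x^*\le z$), and $\mathrm{Hyp}$ = \{$\lfloor e\rfloor=0$ for unsatisfiable $e$; $\lfloor e_0\rfloor;\lfloor x:=e\rfloor;\neg\lfloor e_1\rfloor=0$ when $e_0\Rightarrow e_1[x:=e]$ valid; $\lfloor e_0\rfloor;\lfloor\mathsf{havoc}\,x\rfloor;\neg\lfloor e_1\rfloor=0$ when $e_0\Rightarrow\forall x.e_1$ valid\}. The rules of RHL+ are: rGhost (from $c\mid c':\langle\mathcal{R}\Rightarrow\mathcal{S}\rangle$, $\mathrm{ghost}(x,c)$, $\mathrm{ghost}(x',c')$, $\mathrm{indep}(x|x',\mathcal{R})$, $\mathrm{indep}(x|x',\mathcal{S})$ infer $\mathrm{erase}(x,c)\mid\mathrm{erase}(x',c'):\langle\mathcal{R}\Rightarrow\mathcal{S}\rangle$); rRewrite (from $c\mid c':\langle\mathcal{R}\Rightarrow\mathcal{S}\rangle$, $c\simeq d$, $c'\simeq d'$ infer $d\mid d':\langle\mathcal{R}\Rightarrow\mathcal{S}\rangle$); rSkip $\mathsf{skip}\mid\mathsf{skip}:\langle\mathcal{R}\Rightarrow\mathcal{R}\rangle$;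 rAsgnSkip $x:=e\mid\mathsf{skip}:\langle\mathcal{R}[x|:=e|]\Rightarrow\mathcal{R}\rangle$; rSkipAsgn $\mathsf{skip}\mid x:=e:\langle\mathcal{R}[|x:=|e]\Rightarrow\mathcal{R}\rangle$; rHavSkip $\mathsf{havoc}\,x\mid\mathsf{skip}:\langle(\forall x|.\mathcal{P})\Rightarrow\mathcal{P}\rangle$; rSkipHav $\mathsf{skip}\mid\mathsf{havoc}\,x:\langle(\forall|x.\mathcal{P})\Rightarrow\mathcal{P}\rangle$; rSeq (from $c\mid c':\langle\mathcal{R}\Rightarrow\mathcal{S}\rangle$, $d\mid d':\langle\mathcal{S}\Rightarrow\mathcal{T}\rangle$ infer $c;d\mid c';d':\langle\mathcal{R}\Rightarrow\mathcal{T}\rangle$); rIf (from $c\mid c':\langle\mathcal{R}\wedge\langle e]\wedge[e'\rangle\Rightarrow\mathcal{S}\rangle$ for all $e\to c\in gcs$, $e'\to c'\in gcs'$ infer $\mathsf{if}\,gcs\,\mathsf{fi}\mid\mathsf{if}\,gcs'\,\mathsf{fi}:\langle\mathcal{R}\Rightarrow\mathcal{S}\rangle$); rDo (for relations $\mathcal{Q},\mathcal{L},\mathcal{R}$: from $c\mid\mathsf{skip}:\langle\mathcal{Q}\wedge\langle e]\wedge\mathcal{L}\Rightarrow\mathcal{Q}\rangle$ for all $e\to c\in gcs$, $\mathsf{skip}\mid c':\langle\mathcal{Q}\wedge[e'\rangle\wedge\mathcal{R}\Rightarrow\mathcal{Q}\rangle$ for all $e'\to c'\in gcs'$, $c\mid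 c':\langle\mathcal{Q}\wedge\langle e]\wedge[e'\rangle\wedge\neg\mathcal{L}\wedge\neg\mathcal{R}\Rightarrow\mathcal{Q}\rangle$ for all such pairs, and $\mathcal{Q}\Rightarrow(\langle\mathrm{enab}(gcs)|=|\mathrm{enab}(gcs')\rangle\vee(\mathcal{L}\wedge\langle\mathrm{enab}(gcs)])\vee(\mathcal{R}\wedge[\mathrm{enab}(gcs')\rangle))$, infer $\mathsf{do}\,gcs\,\mathsf{od}\mid\mathsf{do}\,gcs'\,\mathsf{od}:\langle\mathcal{Q}\Rightarrow\mathcal{Q}\wedge\neg\langle\mathrm{enab}(gcs)]\wedge\neg[\mathrm{enab}(gcs')\rangle\rangle$); rConseq (from $\mathcal{P}\Rightarrow\mathcal{R}$, $c\mid d:\langle\mathcal{R}\Rightarrow\mathcal{S}\rangle$, $\mathcal{S}\Rightarrow\mathcal{Q}$ infer $c\mid d:\langle\mathcal{P}\Rightarrow\mathcal{Q}\rangle$); rDisj (from $c\mid d:\langle\mathcal{Q}\Rightarrow\mathcal{S}\rangle$ and $c\mid d:\langle\mathcal{R}\Rightarrow\mathcal{S}\rangle$ infer $c\mid d:\langle\mathcal{Q}\vee\mathcal{R}\Rightarrow\mathcal{S}\rangle$); rFalse $c\mid d:\langle\mathit{false}\Rightarrow\mathcal{R}\rangle$. Entailments between relations (e.g., in rConseq) are taken as semantic inclusions. *)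

theory Defs
  imports Main
begin

text \<open>The expression language is arbitrary: integer operators (including literals, as nullary
  operators) and primitive predicates come from a signature with an arbitrary interpretation.\<close>

class int_op =
  fixes int_op :: "'a \<Rightarrow> int list \<Rightarrow> int"

class bool_op =
  fixes bool_op :: "'a \<Rightarrow> int list \<Rightarrow> bool"

type_synonym 'v store = "'v \<Rightarrow> int"
type_synonym 'v srel = "('v store \<times> 'v store) set"

datatype ('v, 'o) iexp =
    IVar 'v
  | IOp 'o "('v, 'o) iexp list"

datatype ('v, 'o, 'p) bprim = Pred 'p "('v, 'o) iexp list"

datatype ('v, 'o, 'p) bexp =
    BPrim "('v, 'o, 'p) bprim"
  | BAnd "('v, 'o, 'p) bexp" "('v, 'o, 'p) bexp"
  | BOr "('v, 'o, 'p) bexp" "('v, 'o, 'p) bexp"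
  | BNot "('v, 'o, 'p) bexp"

text \<open>The type \<open>gcs\<close> is that of nonempty lists of guarded commands.\<close>

datatype ('v, 'o, 'p) com =
    Skip int
  | Assign int 'v "('v, 'o) iexp"
  | Havoc int 'v
  | Seq "('v, 'o, 'p) com" "('v, 'o, 'p) com"
  | IfFi int "('v, 'o, 'p) gcs"
  | DoOd int "('v, 'o, 'p) gcs"
and ('v, 'o, 'p) gcs =
    GC "('v, 'o, 'p) bexp" "('v, 'o, 'p) com"
  | GCons "('v, 'o, 'p) bexp" "('v, 'o, 'p) com" "('v, 'o, 'p) gcs"

primrec ivars :: "('v, 'o) iexp \<Rightarrow> 'v set" where
  "ivars (IVar x) = {x}"
| "ivars (IOp g es) = \<Union> (set (map ivars es))"

primrec pvars :: "('v, 'o, 'p) bprim \<Rightarrow> 'v set" where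
  "pvars (Pred p es) = \<Union> (set (map ivars es))"

primrec bvars :: "('v, 'o, 'p) bexp \<Rightarrow> 'v set" where
  "bvars (BPrim b) = pvars b"
| "bvars (BAnd e e') = bvars e \<union> bvars e'"
| "bvars (BOr e e') = bvars e \<union> bvars e'"
| "bvars (BNot e) = bvars e"

primrec ival :: "('v, 'o::int_op) iexp \<Rightarrow> 'v store \<Rightarrow> int" where
  "ival (IVar x) s = s x"
| "ival (IOp g es) s = int_op g (map (\<lambda>e. ival e s) es)"

primrec pval :: "('v, 'o::int_op, 'p::bool_op) bprim \<Rightarrow> 'v store \<Rightarrow> bool" where
  "pval (Pred p es) s = bool_op p (map (\<lambda>e. ival e s) es)"

primrec bval :: "('v, 'o::int_op, 'p::bool_op) bexp \<Rightarrow> 'v store \<Rightarrow> bool" where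
  "bval (BPrim b) s = pval b s"
| "bval (BAnd e e') s = (bval e s \<and> bval e' s)"
| "bval (BOr e e') s = (bval e s \<or> bval e' s)"
| "bval (BNot e) s = (\<not> bval e s)"

definition bden :: "('v, 'o::int_op, 'p::bool_op) bexp \<Rightarrow> 'v store set" where
  "bden e = {s. bval e s}"

primrec isubst :: "'v \<Rightarrow> ('v, 'o) iexp \<Rightarrow> ('v, 'o) iexp \<Rightarrow> ('v, 'o) iexp" where
  "isubst x a (IVar y) = (if y = x then a else IVar y)"
| "isubst x a (IOp g es) = IOp g (map (isubst x a) es)"

primrec psubst :: "'v \<Rightarrow> ('v, 'o) iexp \<Rightarrow> ('v, 'o, 'p) bprim \<Rightarrow> ('v, 'o, 'p) bprim" where
  "psubst x a (Pred p es) = Pred p (map (isubst x a) es)"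

primrec bsubst :: "'v \<Rightarrow> ('v, 'o) iexp \<Rightarrow> ('v, 'o, 'p) bexp \<Rightarrow> ('v, 'o, 'p) bexp" where
  "bsubst x a (BPrim b) = BPrim (psubst x a b)"
| "bsubst x a (BAnd e e') = BAnd (bsubst x a e) (bsubst x a e')"
| "bsubst x a (BOr e e') = BOr (bsubst x a e) (bsubst x a e')"
| "bsubst x a (BNot e) = BNot (bsubst x a e)"

primrec gset :: "('v, 'o, 'p) gcs \<Rightarrow> (('v, 'o, 'p) bexp \<times> ('v, 'o, 'p) com) set" where
  "gset (GC e c) = {(e, c)}"
| "gset (GCons e c gcs) = insert (e, c) (gset gcs)"

primrec enab :: "('v, 'o, 'p) gcs \<Rightarrow> ('v, 'o, 'p) bexp" where
  "enab (GC e c) = e"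
| "enab (GCons e c gcs) = BOr e (enab gcs)"

text \<open>Well-typedness is enforced by the datatypes; what remains is totality of if-commands.\<close>

primrec wf_com :: "('v, 'o::int_op, 'p::bool_op) com \<Rightarrow> bool"
  and wf_gcs :: "('v, 'o, 'p) gcs \<Rightarrow> bool" where
  "wf_com (Skip n) = True"
| "wf_com (Assign n x e) = True"
| "wf_com (Havoc n x) = True"
| "wf_com (Seq c d) = (wf_com c \<and> wf_com d)"
| "wf_com (IfFi n gcs) = ((\<forall>s. bval (enab gcs) s) \<and> wf_gcs gcs)"
| "wf_com (DoOd n gcs) = wf_gcs gcs"
| "wf_gcs (GC e c) = wf_com c"
| "wf_gcs (GCons e c gcs) = (wf_com c \<and> wf_gcs gcs)"

primrec lab :: "('v, 'o, 'p) com \<Rightarrow> int" where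
  "lab (Skip n) = n"
| "lab (Assign n x e) = n"
| "lab (Havoc n x) = n"
| "lab (Seq c d) = lab c"
| "lab (IfFi n gcs) = n"
| "lab (DoOd n gcs) = n"

primrec lab_list :: "('v, 'o, 'p) com \<Rightarrow> int list"
  and lab_list_gcs :: "('v, 'o, 'p) gcs \<Rightarrow> int list" where
  "lab_list (Skip n) = [n]"
| "lab_list (Assign n x e) = [n]"
| "lab_list (Havoc n x) = [n]"
| "lab_list (Seq c d) = lab_list c @ lab_list d"
| "lab_list (IfFi n gcs) = n # lab_list_gcs gcs"
| "lab_list (DoOd n gcs) = n # lab_list_gcs gcs"
| "lab_list_gcs (GC e c) = lab_list c"
| "lab_list_gcs (GCons e c gcs) = lab_list c @ lab_list_gcs gcs"

definition labs :: "('v, 'o, 'p) com \<Rightarrow> int set" where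
  "labs c = set (lab_list c)"

definition okf :: "('v, 'o, 'p) com \<Rightarrow> int \<Rightarrow> bool" where
  "okf c f \<longleftrightarrow> (\<forall>n \<in> labs c. n > 0) \<and> distinct (lab_list c) \<and> f \<notin> labs c"

text \<open>The subcommand with label \<open>n\<close> that is not a sequence; \<open>None\<close> if there is no such label.\<close>

primrec sub :: "int \<Rightarrow> ('v, 'o, 'p) com \<Rightarrow> ('v, 'o, 'p) com option"
  and sub_gcs :: "int \<Rightarrow> ('v, 'o, 'p) gcs \<Rightarrow> ('v, 'o, 'p) com option" where
  "sub n (Skip m) = (if n = m then Some (Skip m) else None)"
| "sub n (Assign m x e) = (if n = m then Some (Assign m x e) else None)"
| "sub n (Havoc m x) = (if n = m then Some (Havoc m x) else None)"
| "sub n (Seq c d) = (if n \<in> labs c then sub n c else sub n d)"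
| "sub n (IfFi m gcs) = (if n = m then Some (IfFi m gcs) else sub_gcs n gcs)"
| "sub n (DoOd m gcs) = (if n = m then Some (DoOd m gcs) else sub_gcs n gcs)"
| "sub_gcs n (GC e c) = sub n c"
| "sub_gcs n (GCons e c gcs) = (if n \<in> labs c then sub n c else sub_gcs n gcs)"

text \<open>Only meaningful for \<open>fsuc n c f\<close> with \<open>n \<in> labs c\<close>.\<close>

primrec fsuc :: "int \<Rightarrow> ('v, 'o, 'p) com \<Rightarrow> int \<Rightarrow> int"
  and fsuc_gcs :: "int \<Rightarrow> ('v, 'o, 'p) gcs \<Rightarrow> int \<Rightarrow> int" where
  "fsuc n (Skip m) f = f"
| "fsuc n (Assign m x e) f = f"
| "fsuc n (Havoc m x) f = f"
| "fsuc n (Seq c d) f = (if n \<in> labs c then fsuc n c (lab d) else fsuc n d f)"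
| "fsuc n (IfFi m gcs) f = (if n = m then f else fsuc_gcs n gcs f)"
| "fsuc n (DoOd m gcs) f = (if n = m then f else fsuc_gcs n gcs m)"
| "fsuc_gcs n (GC e c) f = fsuc n c f"
| "fsuc_gcs n (GCons e c gcs) f = (if n \<in> labs c then fsuc n c f else fsuc_gcs n gcs f)"

inductive small_step ::
  "('v, 'o::int_op, 'p::bool_op) com \<times> 'v store \<Rightarrow> ('v, 'o, 'p) com \<times> 'v store \<Rightarrow> bool"
  (infix \<open>\<leadsto>\<close> 55) where
  Havoc: "(Havoc n x, s) \<leadsto> (Skip (- n), s(x := v))"
| Assign: "(Assign n x e, s) \<leadsto> (Skip (- n), s(x := ival e s))"
| SeqSkip: "(Seq (Skip n) c, s) \<leadsto> (c, s)"
| IfFi: "(e, c) \<in> gset gcs \<Longrightarrow> bval e s \<Longrightarrow> (IfFi n gcs, s) \<leadsto> (c, s)"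
| DoIter: "(e, c) \<in> gset gcs \<Longrightarrow> bval e s \<Longrightarrow> (DoOd n gcs, s) \<leadsto> (Seq c (DoOd n gcs), s)"
| DoExit: "\<not> bval (enab gcs) s \<Longrightarrow> (DoOd n gcs, s) \<leadsto> (Skip (- n), s)"
| Seq: "(c, s) \<leadsto> (d, t) \<Longrightarrow> (Seq c b, s) \<leadsto> (Seq d b, t)"

text \<open>The store set of an automaton is the type \<open>'s\<close>.\<close>

record ('c, 's) automaton =
  ctrl :: "'c set"
  init :: 'c
  fin :: 'c
  moves :: "(('c \<times> 's) \<times> ('c \<times> 's)) set"

definition aut :: "('v, 'o::int_op, 'p::bool_op) com \<Rightarrow> int \<Rightarrow> (int, 'v store) automaton" where
  "aut c f =
    \<lparr> ctrl = labs c \<union> {f}, init = lab c, fin = f,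
      moves = {((n, s), (m, t)).
        (\<exists>b d. sub n c = Some b \<and> (b, s) \<leadsto> (d, t) \<and> lab d > 0 \<and> m = lab d) \<or>
        (\<exists>b d. sub n c = Some b \<and> (b, s) \<leadsto> (d, t) \<and> lab d < 0 \<and> m = fsuc n c f) \<or>
        (sub n c = Some (Skip n) \<and> m = fsuc n c f \<and> t = s)} \<rparr>"

type_synonym ('c, 'd, 's, 't) pstates = "(('c \<times> 'd) \<times> ('s \<times> 't)) set"

definition live_align ::
  "('c, 's) automaton \<Rightarrow> ('d, 't) automaton \<Rightarrow>
   ('c, 'd, 's, 't) pstates \<Rightarrow> ('c, 'd, 's, 't) pstates \<Rightarrow> ('c, 'd, 's, 't) pstates \<Rightarrow> bool" where
  "live_align A A' L R J \<longleftrightarrow>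
    L \<subseteq> (ctrl A \<times> ctrl A') \<times> UNIV \<and>
    R \<subseteq> (ctrl A \<times> ctrl A') \<times> UNIV \<and>
    J \<subseteq> (ctrl A \<times> ctrl A') \<times> UNIV \<and>
    (\<forall>n n' s s'. ((n, n'), (s, s')) \<in> L \<longrightarrow> (\<exists>q. ((n, s), q) \<in> moves A)) \<and>
    (\<forall>n n' s s'. ((n, n'), (s, s')) \<in> R \<longrightarrow> (\<exists>q'. ((n', s'), q') \<in> moves A')) \<and>
    (\<forall>n n' s s'. ((n, n'), (s, s')) \<in> J \<longrightarrow>
      (\<exists>q. ((n, s), q) \<in> moves A) \<and> (\<exists>q'. ((n', s'), q') \<in> moves A'))"

definition align_prod ::
  "('c, 's) automaton \<Rightarrow> ('d, 't) automaton \<Rightarrow>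
   ('c, 'd, 's, 't) pstates \<Rightarrow> ('c, 'd, 's, 't) pstates \<Rightarrow> ('c, 'd, 's, 't) pstates \<Rightarrow>
   ('c \<times> 'd, 's \<times> 't) automaton" where
  "align_prod A A' L R J =
    \<lparr> ctrl = ctrl A \<times> ctrl A', init = (init A, init A'), fin = (fin A, fin A'),
      moves = {(((n, n'), (s, s')), ((m, m'), (t, t'))).
        (((n, n'), (s, s')) \<in> L \<and> ((n, s), (m, t)) \<in> moves A \<and> (n', s') = (m', t')) \<or>
        (((n, n'), (s, s')) \<in> R \<and> (n, s) = (m, t) \<and> ((n', s'), (m', t')) \<in> moves A') \<or>
        (((n, n'), (s, s')) \<in> J \<and> ((n, s), (m, t)) \<in> moves A \<and> ((n', s'), (m', t')) \<in> moves A')} \<rparr>"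

definition annotation :: "('c, 's) automaton \<Rightarrow> 's set \<Rightarrow> 's set \<Rightarrow> ('c \<Rightarrow> 's set) \<Rightarrow> bool" where
  "annotation A S T an \<longleftrightarrow> an (init A) = S \<and> an (fin A) = T"

definition valid_annotation :: "('c, 's) automaton \<Rightarrow> ('c \<Rightarrow> 's set) \<Rightarrow> bool" where
  "valid_annotation A an \<longleftrightarrow>
    (\<forall>n s m t. s \<in> an n \<and> ((n, s), (m, t)) \<in> moves A \<longrightarrow> t \<in> an m)"

definition an_states :: "('c \<Rightarrow> 's set) \<Rightarrow> 'c \<Rightarrow> ('c \<times> 's) set" where
  "an_states an n = {(n, s) | s. s \<in> an n}"

definition at_ctrl :: "'c \<Rightarrow> 'd \<Rightarrow> ('c, 'd, 's, 't) pstates" where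
  "at_ctrl f f' = {((f, f'), (s, s')) | s s'. True}"

text \<open>KAT expressions. Complement is meant for tests only: no axiom below applies to the complement
  of an expression that is not a test.\<close>

datatype ('a, 'b) kat =
    KZero
  | KOne
  | KAct 'a
  | KPrim 'b
  | KNot "('a, 'b) kat"
  | KPlus "('a, 'b) kat" "('a, 'b) kat"
  | KSeq "('a, 'b) kat" "('a, 'b) kat"
  | KStar "('a, 'b) kat"

primrec is_test :: "('a, 'b) kat \<Rightarrow> bool" where
  "is_test KZero = True"
| "is_test KOne = True"
| "is_test (KAct a) = False"
| "is_test (KPrim b) = True"
| "is_test (KNot x) = is_test x"
| "is_test (KPlus x y) = (is_test x \<and> is_test y)"
| "is_test (KSeq x y) = (is_test x \<and> is_test y)"
| "is_test (KStar x) = False"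

text \<open>Derivability of equations from hypotheses \<open>H\<close>. The inequation \<open>x \<le> y\<close> is \<open>x + y = y\<close>. For the
  tests, Huntington's axioms are completed by the semiring laws.\<close>

inductive kat_deriv ::
  "(('a, 'b) kat \<times> ('a, 'b) kat) set \<Rightarrow> ('a, 'b) kat \<Rightarrow> ('a, 'b) kat \<Rightarrow> bool"
  for H where
  hyp: "(x, y) \<in> H \<Longrightarrow> kat_deriv H x y"
| refl: "kat_deriv H x x"
| sym: "kat_deriv H x y \<Longrightarrow> kat_deriv H y x"
| trans: "kat_deriv H x y \<Longrightarrow> kat_deriv H y z \<Longrightarrow> kat_deriv H x z"
| cong_not: "is_test a \<Longrightarrow> is_test b \<Longrightarrow> kat_deriv H a b \<Longrightarrow> kat_deriv H (KNot a) (KNot b)"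
| cong_plus: "kat_deriv H x x' \<Longrightarrow> kat_deriv H y y' \<Longrightarrow> kat_deriv H (KPlus x y) (KPlus x' y')"
| cong_seq: "kat_deriv H x x' \<Longrightarrow> kat_deriv H y y' \<Longrightarrow> kat_deriv H (KSeq x y) (KSeq x' y')"
| cong_star: "kat_deriv H x x' \<Longrightarrow> kat_deriv H (KStar x) (KStar x')"
| plus_assoc: "kat_deriv H (KPlus (KPlus x y) z) (KPlus x (KPlus y z))"
| plus_comm: "kat_deriv H (KPlus x y) (KPlus y x)"
| plus_idem: "kat_deriv H (KPlus x x) x"
| plus_zero: "kat_deriv H (KPlus x KZero) x"
| seq_assoc: "kat_deriv H (KSeq (KSeq x y) z) (KSeq x (KSeq y z))"
| one_seq: "kat_deriv H (KSeq KOne x) x"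
| seq_one: "kat_deriv H (KSeq x KOne) x"
| zero_seq: "kat_deriv H (KSeq KZero x) KZero"
| seq_zero: "kat_deriv H (KSeq x KZero) KZero"
| distl: "kat_deriv H (KSeq x (KPlus y z)) (KPlus (KSeq x y) (KSeq x z))"
| distr: "kat_deriv H (KSeq (KPlus x y) z) (KPlus (KSeq x z) (KSeq y z))"
| test_comm: "is_test a \<Longrightarrow> is_test b \<Longrightarrow> kat_deriv H (KSeq a b) (KSeq b a)"
| test_dist: "is_test a \<Longrightarrow> is_test b \<Longrightarrow> is_test c \<Longrightarrow>
    kat_deriv H (KPlus a (KSeq b c)) (KSeq (KPlus a b) (KPlus a c))"
| test_compl_plus: "is_test a \<Longrightarrow> kat_deriv H (KPlus a (KNot a)) KOne"
| test_compl_seq: "is_test a \<Longrightarrow> kat_deriv H (KSeq a (KNot a)) KZero"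
| star_unfoldl: "kat_deriv H (KPlus KOne (KSeq x (KStar x))) (KStar x)"
| star_unfoldr: "kat_deriv H (KPlus KOne (KSeq (KStar x) x)) (KStar x)"
| star_inductl: "kat_deriv H (KPlus (KPlus y (KSeq x z)) z) z \<Longrightarrow>
    kat_deriv H (KPlus (KSeq (KStar x) y) z) z"
| star_inductr: "kat_deriv H (KPlus (KPlus y (KSeq z x)) z) z \<Longrightarrow>
    kat_deriv H (KPlus (KSeq y (KStar x)) z) z"

datatype ('v, 'o) act = AAssign 'v "('v, 'o) iexp" | AHavoc 'v

type_synonym ('v, 'o, 'p) gkat = "(('v, 'o) act, ('v, 'o, 'p) bprim) kat"

primrec kat_bexp :: "('v, 'o, 'p) bexp \<Rightarrow> ('v, 'o, 'p) gkat" where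
  "kat_bexp (BPrim b) = KPrim b"
| "kat_bexp (BAnd e e') = KSeq (kat_bexp e) (kat_bexp e')"
| "kat_bexp (BOr e e') = KPlus (kat_bexp e) (kat_bexp e')"
| "kat_bexp (BNot e) = KNot (kat_bexp e)"

primrec kat_com :: "('v, 'o, 'p) com \<Rightarrow> ('v, 'o, 'p) gkat"
  and kat_gcs :: "('v, 'o, 'p) gcs \<Rightarrow> ('v, 'o, 'p) gkat" where
  "kat_com (Skip n) = KOne"
| "kat_com (Assign n x e) = KAct (AAssign x e)"
| "kat_com (Havoc n x) = KAct (AHavoc x)"
| "kat_com (Seq c d) = KSeq (kat_com c) (kat_com d)"
| "kat_com (IfFi n gcs) = kat_gcs gcs"
| "kat_com (DoOd n gcs) = KSeq (KStar (kat_gcs gcs)) (KNot (kat_bexp (enab gcs)))"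
| "kat_gcs (GC e c) = KSeq (kat_bexp e) (kat_com c)"
| "kat_gcs (GCons e c gcs) = KPlus (KSeq (kat_bexp e) (kat_com c)) (kat_gcs gcs)"

inductive_set Hyp :: "(('v, 'o::int_op, 'p::bool_op) gkat \<times> ('v, 'o, 'p) gkat) set" where
  unsat: "(\<And>s. \<not> bval e s) \<Longrightarrow> (kat_bexp e, KZero) \<in> Hyp"
| assign: "(\<And>s. bval e0 s \<Longrightarrow> bval (bsubst x e e1) s) \<Longrightarrow>
    (KSeq (KSeq (kat_bexp e0) (KAct (AAssign x e))) (KNot (kat_bexp e1)), KZero) \<in> Hyp"
| havoc: "(\<And>s. bval e0 s \<Longrightarrow> \<forall>v. bval e1 (s(x := v))) \<Longrightarrow>
    (KSeq (KSeq (kat_bexp e0) (KAct (AHavoc x))) (KNot (kat_bexp e1)), KZero) \<in> Hyp"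

definition kat_equiv ::
  "('v, 'o::int_op, 'p::bool_op) com \<Rightarrow> ('v, 'o, 'p) com \<Rightarrow> bool" (infix \<open>\<simeq>\<close> 50) where
  "c \<simeq> d \<longleftrightarrow> kat_deriv Hyp (kat_com c) (kat_com d)"

definition lrel :: "'v store set \<Rightarrow> 'v srel" where
  "lrel P = {(s, s'). s \<in> P}"

definition rrel :: "'v store set \<Rightarrow> 'v srel" where
  "rrel P = {(s, s'). s' \<in> P}"

definition agree ::
  "('v, 'o::int_op, 'p::bool_op) bexp \<Rightarrow> ('v, 'o, 'p) bexp \<Rightarrow> 'v srel" where
  "agree e e' = {(s, s'). bval e s = bval e' s'}"

definition subst_left :: "'v srel \<Rightarrow> 'v \<Rightarrow> ('v, 'o::int_op) iexp \<Rightarrow> 'v srel" where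
  "subst_left R x e = {(s, s'). (s(x := ival e s), s') \<in> R}"

definition subst_right :: "'v srel \<Rightarrow> 'v \<Rightarrow> ('v, 'o::int_op) iexp \<Rightarrow> 'v srel" where
  "subst_right R x e = {(s, s'). (s, s'(x := ival e s')) \<in> R}"

definition all_left :: "'v \<Rightarrow> 'v srel \<Rightarrow> 'v srel" where
  "all_left x P = {(s, s'). \<forall>v. (s(x := v), s') \<in> P}"

definition all_right :: "'v \<Rightarrow> 'v srel \<Rightarrow> 'v srel" where
  "all_right x P = {(s, s'). \<forall>v. (s, s'(x := v)) \<in> P}"

definition indep :: "'v \<Rightarrow> 'v \<Rightarrow> 'v srel \<Rightarrow> bool" where
  "indep x x' R \<longleftrightarrow> R = {(s, s'). \<exists>v v'. (s(x := v), s'(x' := v')) \<in> R}"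

primrec ghost :: "'v \<Rightarrow> ('v, 'o, 'p) com \<Rightarrow> bool"
  and ghost_gcs :: "'v \<Rightarrow> ('v, 'o, 'p) gcs \<Rightarrow> bool" where
  "ghost x (Skip n) = True"
| "ghost x (Assign n y e) = (x \<notin> ivars e)"
| "ghost x (Havoc n y) = True"
| "ghost x (Seq c d) = (ghost x c \<and> ghost x d)"
| "ghost x (IfFi n gcs) = ghost_gcs x gcs"
| "ghost x (DoOd n gcs) = ghost_gcs x gcs"
| "ghost_gcs x (GC e c) = (x \<notin> bvars e \<and> ghost x c)"
| "ghost_gcs x (GCons e c gcs) = (x \<notin> bvars e \<and> ghost x c \<and> ghost_gcs x gcs)"

primrec erase :: "'v \<Rightarrow> ('v, 'o, 'p) com \<Rightarrow> ('v, 'o, 'p) com"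
  and erase_gcs :: "'v \<Rightarrow> ('v, 'o, 'p) gcs \<Rightarrow> ('v, 'o, 'p) gcs" where
  "erase x (Skip n) = Skip n"
| "erase x (Assign n y e) = (if y = x then Skip n else Assign n y e)"
| "erase x (Havoc n y) = (if y = x then Skip n else Havoc n y)"
| "erase x (Seq c d) = Seq (erase x c) (erase x d)"
| "erase x (IfFi n gcs) = IfFi n (erase_gcs x gcs)"
| "erase x (DoOd n gcs) = DoOd n (erase_gcs x gcs)"
| "erase_gcs x (GC e c) = GC e (erase x c)"
| "erase_gcs x (GCons e c gcs) = GCons e (erase x c) (erase_gcs x gcs)"

text \<open>\<open>rhl_plus c c' R S\<close> is provability of the judgment \<open>c | c' : R \<Rightarrow> S\<close>. Labels are irrelevant in
  the logic, hence arbitrary in the rules. The \<open>wf_com\<close> premises confine derivations to judgments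
  about well-formed commands.\<close>

inductive rhl_plus ::
  "('v, 'o::int_op, 'p::bool_op) com \<Rightarrow> ('v, 'o, 'p) com \<Rightarrow> 'v srel \<Rightarrow> 'v srel \<Rightarrow> bool" where
  rGhost: "rhl_plus c c' R S \<Longrightarrow> ghost x c \<Longrightarrow> ghost x' c' \<Longrightarrow> indep x x' R \<Longrightarrow> indep x x' S \<Longrightarrow>
    rhl_plus (erase x c) (erase x' c') R S"
| rRewrite: "rhl_plus c c' R S \<Longrightarrow> c \<simeq> d \<Longrightarrow> c' \<simeq> d' \<Longrightarrow> wf_com d \<Longrightarrow> wf_com d' \<Longrightarrow>
    rhl_plus d d' R S"
| rSkip: "rhl_plus (Skip n) (Skip n') R R"
| rAsgnSkip: "rhl_plus (Assign n x e) (Skip n') (subst_left R x e) R"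
| rSkipAsgn: "rhl_plus (Skip n) (Assign n' x e) (subst_right R x e) R"
| rHavSkip: "rhl_plus (Havoc n x) (Skip n') (all_left x P) P"
| rSkipHav: "rhl_plus (Skip n) (Havoc n' x) (all_right x P) P"
| rSeq: "rhl_plus c c' R S \<Longrightarrow> rhl_plus d d' S T \<Longrightarrow> rhl_plus (Seq c d) (Seq c' d') R T"
| rIf: "(\<And>e c e' c'. (e, c) \<in> gset gcs \<Longrightarrow> (e', c') \<in> gset gcs' \<Longrightarrow>
        rhl_plus c c' (R \<inter> lrel (bden e) \<inter> rrel (bden e')) S) \<Longrightarrow>
    wf_com (IfFi n gcs) \<Longrightarrow> wf_com (IfFi n' gcs') \<Longrightarrow>
    rhl_plus (IfFi n gcs) (IfFi n' gcs') R S"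
| rDo: "(\<And>e c. (e, c) \<in> gset gcs \<Longrightarrow>
        rhl_plus c (Skip k) (Q \<inter> lrel (bden e) \<inter> L) Q) \<Longrightarrow>
    (\<And>e' c'. (e', c') \<in> gset gcs' \<Longrightarrow>
        rhl_plus (Skip k') c' (Q \<inter> rrel (bden e') \<inter> R) Q) \<Longrightarrow>
    (\<And>e c e' c'. (e, c) \<in> gset gcs \<Longrightarrow> (e', c') \<in> gset gcs' \<Longrightarrow>
        rhl_plus c c' (Q \<inter> lrel (bden e) \<inter> rrel (bden e') \<inter> - L \<inter> - R) Q) \<Longrightarrow>
    Q \<subseteq> agree (enab gcs) (enab gcs') \<union> (L \<inter> lrel (bden (enab gcs))) \<union>
        (R \<inter> rrel (bden (enab gcs'))) \<Longrightarrow>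
    rhl_plus (DoOd n gcs) (DoOd n' gcs') Q
      (Q \<inter> - lrel (bden (enab gcs)) \<inter> - rrel (bden (enab gcs')))"
| rConseq: "P \<subseteq> R \<Longrightarrow> rhl_plus c d R S \<Longrightarrow> S \<subseteq> Q \<Longrightarrow> rhl_plus c d P Q"
| rDisj: "rhl_plus c d Q S \<Longrightarrow> rhl_plus c d R S \<Longrightarrow> rhl_plus c d (Q \<union> R) S"
| rFalse: "wf_com c \<Longrightarrow> wf_com d \<Longrightarrow> rhl_plus c d {} R"

end

theory Submission imports Defs begin

text \<open>Since assertions are arbitrary relations on stores, RHL+ is complete for semantic validity
  already through the fully sequential alignment: with \<open>Q\<close> the strongest postcondition of \<open>S\<close>
  under a run of \<open>c\<close> on the left, derive \<open>c | skip : S \<Rightarrow> Q\<close> and \<open>skip | c' : Q \<Rightarrow> T\<close>, compose,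
  and remove the skips by KAT rewriting. The one-sided judgments follow by structural induction,
  where \<open>skip\<close> is rewritten to a trivial if or a trivial loop so that the two-sided rules apply.

  It remains to see that the annotation makes \<open>c | c' : S \<Rightarrow> T\<close> semantically valid. Given
  terminating runs of both automata, a state of the annotation lies in \<open>L\<close>, \<open>R\<close>, \<open>J\<close> or is final; by
  liveness the runs selected by \<open>L\<close>, \<open>R\<close> or \<open>J\<close> are not yet finished, so the product can follow
  them, and the total remaining length decreases until the final control is reached. No ghost
  variables are needed.\<close>

section \<open>Relational semantics\<close>

text \<open>Terminating executions only, matching partial correctness. Recursion on the syntax
  replaces \<open>\<leadsto>\<close>, so that completeness of the logic can go by structural
  induction. \<open>den_gcs\<close> is one guarded choice, hence also one loop iteration.\<close>

primrec den :: "('v, 'o::int_op, 'p::bool_op) com \<Rightarrow> 'v store rel"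
  and den_gcs :: "('v, 'o, 'p) gcs \<Rightarrow> 'v store rel" where
  "den (Skip n) = Id"
| "den (Assign n x e) = {(s, t). t = s(x := ival e s)}"
| "den (Havoc n x) = {(s, t). \<exists>v. t = s(x := v)}"
| "den (Seq c d) = den c O den d"
| "den (IfFi n gcs) = den_gcs gcs"
| "den (DoOd n gcs) = {(s, t) \<in> (den_gcs gcs)\<^sup>*. \<not> bval (enab gcs) t}"
| "den_gcs (GC e c) = {(s, t) \<in> den c. bval e s}"
| "den_gcs (GCons e c gcs) = {(s, t) \<in> den c. bval e s} \<union> den_gcs gcs"

lemma den_gcs_iff: "(s, t) \<in> den_gcs gcs \<longleftrightarrow> (\<exists>(e, c) \<in> gset gcs. bval e s \<and> (s, t) \<in> den c)"
  by (induction gcs rule: gcs.induct[where ?P1.0 = "\<lambda>_. True"]) auto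

lemma wf_gcs_iff: "wf_gcs gcs \<longleftrightarrow> (\<forall>(e, c) \<in> gset gcs. wf_com c)"
  by (induction gcs rule: gcs.induct[where ?P1.0 = "\<lambda>_. True"]) auto

text \<open>Flattens the mutual recursion: the predicate on guarded lists is fixed to be
  \<open>P\<close> for every body.\<close>

lemma com_gset_induct [case_names Skip Assign Havoc Seq IfFi DoOd]:
  fixes c :: "('v, 'o, 'p) com"
  assumes "\<And>n. P (Skip n)" "\<And>n x e. P (Assign n x e)" "\<And>n x. P (Havoc n x)"
    and "\<And>c d. P c \<Longrightarrow> P d \<Longrightarrow> P (Seq c d)"
    and "\<And>n gcs. (\<And>e c. (e, c) \<in> gset gcs \<Longrightarrow> P c) \<Longrightarrow> P (IfFi n gcs)"
    and "\<And>n gcs. (\<And>e c. (e, c) \<in> gset gcs \<Longrightarrow> P c) \<Longrightarrow> P (DoOd n gcs)"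
  shows "P c"
proof -
  have "P c" and "\<And>e c. (e, c) \<in> gset gcs \<Longrightarrow> P c" for gcs :: "('v, 'o, 'p) gcs"
    by (induction c and gcs rule: com.induct gcs.induct)
      (use assms(1-4) in \<open>auto intro: assms(5,6)\<close>)
  then show ?thesis
    by blast
qed

section \<open>Semantic completeness of RHL+\<close>

lemma kat_equiv_refl: "c \<simeq> c"
  unfolding kat_equiv_def by (rule kat_deriv.refl)

lemma kat_equiv_Seq_Skip: "Seq c (Skip n) \<simeq> c"
  unfolding kat_equiv_def by (simp add: kat_deriv.seq_one)

lemma kat_equiv_Skip_Seq: "Seq (Skip n) c \<simeq> c"
  unfolding kat_equiv_def by (simp add: kat_deriv.one_seq)

lemma is_test_kat_bexp: "is_test (kat_bexp e)"
  by (induction e) auto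

text \<open>\<open>bexp\<close> has no constant for truth, so excluded middle on an arbitrary
  \<open>e\<close> supplies the valid guard.\<close>

lemma kat_equiv_IfFi_Skip: "IfFi n (GC (BOr e (BNot e)) (Skip m)) \<simeq> Skip k"
  unfolding kat_equiv_def
  by (simp add: kat_deriv.trans[OF kat_deriv.seq_one kat_deriv.test_compl_plus] is_test_kat_bexp)

text \<open>Dually, the contradictory guard is 0, so the loop is \<open>0* ; not 0\<close>, that is
  \<open>1 ; 1\<close>.\<close>

lemma kat_equiv_DoOd_Skip: "DoOd n (GC (BAnd e (BNot e)) (Skip m)) \<simeq> Skip k"
proof -
  let ?a = "kat_bexp e" and ?D = "kat_deriv Hyp"
  have a0: "?D (KSeq ?a (KNot ?a)) KZero"
    by (intro kat_deriv.test_compl_seq is_test_kat_bexp)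
  have "?D (KPlus KZero (KNot KZero)) KOne"
    by (intro kat_deriv.test_compl_plus) simp
  then have "?D (KNot KZero) KOne"
    by (meson kat_deriv.plus_zero kat_deriv.plus_comm kat_deriv.trans kat_deriv.sym)
  moreover have "?D (KNot (KSeq ?a (KNot ?a))) (KNot KZero)"
    by (intro kat_deriv.cong_not a0) (simp_all add: is_test_kat_bexp)
  ultimately have neg: "?D (KNot (KSeq ?a (KNot ?a))) KOne"
    by (rule kat_deriv.trans[rotated])
  have "?D (KPlus KOne (KSeq KZero (KStar KZero))) (KPlus KOne KZero)"
    by (intro kat_deriv.cong_plus kat_deriv.refl kat_deriv.zero_seq)
  then have "?D (KStar KZero) KOne"
    by (meson kat_deriv.star_unfoldl kat_deriv.plus_zero kat_deriv.trans kat_deriv.sym)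
  moreover have "?D (KStar (KSeq (KSeq ?a (KNot ?a)) KOne)) (KStar KZero)"
    by (intro kat_deriv.cong_star kat_deriv.trans[OF kat_deriv.seq_one a0])
  ultimately have "?D (KStar (KSeq (KSeq ?a (KNot ?a)) KOne)) KOne"
    by (rule kat_deriv.trans[rotated])
  from kat_deriv.trans[OF kat_deriv.cong_seq[OF this neg] kat_deriv.one_seq] show ?thesis
    by (simp add: kat_equiv_def)
qed

section \<open>Exchange of left and right in derivations\<close>

text \<open>The rules are closed under mirroring: the one-sided assignment and havoc rules swap in
  pairs, every other rule is its own mirror image.\<close>

lemma rhl_plus_converse: "rhl_plus c c' R S \<Longrightarrow> rhl_plus c' c (R\<inverse>) (S\<inverse>)"
proof (induction rule: rhl_plus.induct)
  case (rGhost c c' R S x x')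
  have "indep x' x (Q\<inverse>)" if "indep x x' Q" for Q :: "'a srel"
    using that unfolding indep_def by fast
  with rGhost show ?case
    by (intro rhl_plus.rGhost) auto
next
  case (rAsgnSkip n x e n' R)
  have "(subst_left R x e)\<inverse> = subst_right (R\<inverse>) x e"
    by (auto simp: subst_left_def subst_right_def)
  then show ?case
    by (simp add: rhl_plus.rSkipAsgn)
next
  case (rSkipAsgn n n' x e R)
  have "(subst_right R x e)\<inverse> = subst_left (R\<inverse>) x e"
    by (auto simp: subst_left_def subst_right_def)
  then show ?case
    by (simp add: rhl_plus.rAsgnSkip)
next
  case (rHavSkip n x n' P)
  have "(all_left x P)\<inverse> = all_right x (P\<inverse>)"
    by (auto simp: all_left_def all_right_def)
  then show ?case
    by (simp add: rhl_plus.rSkipHav)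
next
  case (rSkipHav n n' x P)
  have "(all_right x P)\<inverse> = all_left x (P\<inverse>)"
    by (auto simp: all_left_def all_right_def)
  then show ?case
    by (simp add: rhl_plus.rHavSkip)
next
  case (rIf gcs gcs' R S n n')
  have "(R \<inter> lrel (bden e) \<inter> rrel (bden e'))\<inverse> = R\<inverse> \<inter> lrel (bden e') \<inter> rrel (bden e)"
    for e e' :: "('a, 'b, 'c) bexp"
    by (auto simp: lrel_def rrel_def)
  with rIf show ?case
    by (intro rhl_plus.rIf) auto
next
  case (rDo gcs k Q L gcs' k' R n n')
  have "rhl_plus (DoOd n' gcs') (DoOd n gcs) (Q\<inverse>)
      (Q\<inverse> \<inter> - lrel (bden (enab gcs')) \<inter> - rrel (bden (enab gcs)))"
  \<comment> \<open>Left-only and right-only iterations trade places, hence the exchange of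
    \<open>L\<close> with \<open>R\<close> and of \<open>k\<close> with \<open>k'\<close>.\<close>
  proof (rule rhl_plus.rDo[where L = "R\<inverse>" and R = "L\<inverse>" and k = k' and k' = k])
    fix e c assume "(e, c) \<in> gset gcs'"
    moreover have "(Q \<inter> rrel (bden e) \<inter> R)\<inverse> = Q\<inverse> \<inter> lrel (bden e) \<inter> R\<inverse>"
      by (auto simp: lrel_def rrel_def)
    ultimately show "rhl_plus c (Skip k') (Q\<inverse> \<inter> lrel (bden e) \<inter> R\<inverse>) (Q\<inverse>)"
      using rDo.IH(2) by metis
  next
    fix e c assume "(e, c) \<in> gset gcs"
    moreover have "(Q \<inter> lrel (bden e) \<inter> L)\<inverse> = Q\<inverse> \<inter> rrel (bden e) \<inter> L\<inverse>"
      by (auto simp: lrel_def rrel_def)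
    ultimately show "rhl_plus (Skip k) c (Q\<inverse> \<inter> rrel (bden e) \<inter> L\<inverse>) (Q\<inverse>)"
      using rDo.IH(1) by metis
  next
    fix e c e' c' assume "(e, c) \<in> gset gcs'" "(e', c') \<in> gset gcs"
    moreover have "(Q \<inter> lrel (bden e') \<inter> rrel (bden e) \<inter> - L \<inter> - R)\<inverse>
        = Q\<inverse> \<inter> lrel (bden e) \<inter> rrel (bden e') \<inter> - (R\<inverse>) \<inter> - (L\<inverse>)"
      by (auto simp: lrel_def rrel_def)
    ultimately show "rhl_plus c c'
        (Q\<inverse> \<inter> lrel (bden e) \<inter> rrel (bden e') \<inter> - (R\<inverse>) \<inter> - (L\<inverse>)) (Q\<inverse>)"
      using rDo.IH(3) by metis
  next
    show "Q\<inverse> \<subseteq> agree (enab gcs') (enab gcs) \<union> R\<inverse> \<inter> lrel (bden (enab gcs')) \<union>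
        L\<inverse> \<inter> rrel (bden (enab gcs))"
      using rDo.hyps by (fastforce simp: lrel_def rrel_def agree_def)
  qed
  moreover have "(Q \<inter> - lrel (bden (enab gcs)) \<inter> - rrel (bden (enab gcs')))\<inverse>
      = Q\<inverse> \<inter> - lrel (bden (enab gcs')) \<inter> - rrel (bden (enab gcs))"
    by (auto simp: lrel_def rrel_def)
  ultimately show ?case
    by simp
next
  case (rConseq P R c d S Q)
  then show ?case
    by (meson converse_mono rhl_plus.rConseq)
next
  case (rDisj c d Q S R)
  then show ?case
    by (simp add: rhl_plus.rDisj converse_Un)
qed (auto intro: rhl_plus.rRewrite rhl_plus.rSkip rhl_plus.rSeq rhl_plus.rFalse)

section \<open>Completeness for one-sided and two-sided judgments\<close>

lemma rhl_plus_rewrite_Skip_right: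
  assumes "rhl_plus c d R S" and "d \<simeq> Skip k" and "wf_com c"
  shows "rhl_plus c (Skip k) R S"
  using rhl_plus.rRewrite[OF assms(1) kat_equiv_refl assms(2) assms(3)] by simp

text \<open>Assertions are arbitrary sets, so every strongest postcondition and loop invariant is
  available; the right store stays a fixed parameter.\<close>

lemma rhl_plus_left_complete:
  assumes "wf_com c" and "\<And>s s' t. (s, s') \<in> R \<Longrightarrow> (s, t) \<in> den c \<Longrightarrow> (t, s') \<in> S"
  shows "rhl_plus c (Skip k) R S"
  using assms
proof (induction c arbitrary: R S k rule: com_gset_induct)
  case (Skip n)
  then have "R \<subseteq> S" by auto
  then show ?case
    by (rule rhl_plus.rConseq[OF _ rhl_plus.rSkip subset_refl])
next
  case (Assign n x e)
  have "R \<subseteq> subst_left S x e"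
    by (auto simp: subst_left_def fun_upd_def intro!: Assign.prems(2))
  then show ?case
    by (rule rhl_plus.rConseq[OF _ rhl_plus.rAsgnSkip subset_refl])
next
  case (Havoc n x)
  have "R \<subseteq> all_left x S"
    by (auto simp: all_left_def fun_upd_def intro!: Havoc.prems(2))
  then show ?case
    by (rule rhl_plus.rConseq[OF _ rhl_plus.rHavSkip subset_refl])
next
  case (Seq c d)
  \<comment> \<open>Strongest postcondition of \<open>R\<close> under \<open>c\<close>.
    \<open>rSeq\<close> will leave two skips on the right, which KAT collapses to one.\<close>
  define Q where "Q = {(t, s'). \<exists>s. (s, s') \<in> R \<and> (s, t) \<in> den c}"
  have "rhl_plus c (Skip k) R Q"
    using Seq.prems by (intro Seq.IH(1)) (auto simp: Q_def)
  moreover have "rhl_plus d (Skip k) Q S"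
    using Seq.prems by (intro Seq.IH(2)) (auto simp: Q_def)
  ultimately show ?case
    using Seq.prems(1)
    by (intro rhl_plus_rewrite_Skip_right[OF rhl_plus.rSeq kat_equiv_Seq_Skip])
next
  case (IfFi n gcs)
  let ?e = "enab gcs"
  \<comment> \<open>The right skip is expanded to a one-branch conditional so that
    \<open>rIf\<close> applies; the conjunct for its guard can only shrink the precondition.\<close>
  have "rhl_plus (IfFi n gcs) (IfFi n (GC (BOr ?e (BNot ?e)) (Skip k))) R S"
  proof (rule rhl_plus.rIf)
    fix e c e' c'
    assume ec: "(e, c) \<in> gset gcs"
      and "(e', c') \<in> gset (GC (BOr ?e (BNot ?e)) (Skip k))"
    then have "c' = Skip k" by simp
    moreover have "(s, t) \<in> den (IfFi n gcs)" if "bval e s" "(s, t) \<in> den c" for s t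
      using ec that by (auto simp: den_gcs_iff)
    then have "rhl_plus c (Skip k) (R \<inter> lrel (bden e) \<inter> rrel (bden e')) S"
      using ec IfFi.prems
      by (intro IfFi.IH[OF ec]) (auto simp: wf_gcs_iff lrel_def bden_def)
    ultimately show "rhl_plus c c' (R \<inter> lrel (bden e) \<inter> rrel (bden e')) S"
      by simp
  qed (use IfFi.prems in auto)
  then show ?case
    using kat_equiv_IfFi_Skip IfFi.prems(1) by (rule rhl_plus_rewrite_Skip_right)
next
  case (DoOd n gcs)
  let ?e = "enab gcs"
  let ?ff = "GC (BAnd ?e (BNot ?e)) (Skip k)"
  \<comment> \<open>The least invariant containing \<open>R\<close>: left stores reachable by
    finitely many iterations.\<close>
  define Q where "Q = {(t, s'). \<exists>s. (s, s') \<in> R \<and> (s, t) \<in> (den_gcs gcs)\<^sup>*}"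
  have wf: "wf_com c" if "(e, c) \<in> gset gcs" for e c
    using DoOd.prems(1) that by (auto simp: wf_gcs_iff)
  have "R \<subseteq> Q"
    by (auto simp: Q_def)
  moreover have "rhl_plus (DoOd n gcs) (DoOd n ?ff) Q
      (Q \<inter> - lrel (bden ?e) \<inter> - rrel (bden (enab ?ff)))"
  \<comment> \<open>Every iteration is left-only, so the right-only and joint premises start from
    the empty relation. For the side condition, a true left guard is covered by
    \<open>L = UNIV\<close>, and a false one agrees with the contradictory right guard.\<close>
  proof (rule rhl_plus.rDo[where L = UNIV and R = "{}" and k = k and k' = k])
    fix e c assume ec: "(e, c) \<in> gset gcs"
    then have "(s, t) \<in> den_gcs gcs" if "bval e s" "(s, t) \<in> den c" for s t
      using that by (auto simp: den_gcs_iff)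
    then show "rhl_plus c (Skip k) (Q \<inter> lrel (bden e) \<inter> UNIV) Q"
      using wf[OF ec]
      by (intro DoOd.IH[OF ec])
        (auto simp: Q_def lrel_def bden_def intro: rtrancl_into_rtrancl)
  qed (use wf in \<open>auto simp: agree_def lrel_def bden_def intro: rhl_plus.rFalse\<close>)
  moreover have "Q \<inter> - lrel (bden ?e) \<inter> - rrel (bden (enab ?ff)) \<subseteq> S"
    using DoOd.prems(2) by (auto simp: Q_def lrel_def bden_def)
  ultimately have "rhl_plus (DoOd n gcs) (DoOd n ?ff) R S"
    by (rule rhl_plus.rConseq)
  then show ?case
    using kat_equiv_DoOd_Skip DoOd.prems(1) by (rule rhl_plus_rewrite_Skip_right)
qed

lemma rhl_plus_right_complete:
  assumes "wf_com c" and "\<And>s s' t'. (s, s') \<in> R \<Longrightarrow> (s', t') \<in> den c \<Longrightarrow> (s, t') \<in> S"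
  shows "rhl_plus (Skip k) c R S"
proof -
  have "rhl_plus c (Skip k) (R\<inverse>) (S\<inverse>)"
    using assms by (intro rhl_plus_left_complete) auto
  then show ?thesis
    using rhl_plus_converse by force
qed

lemma rhl_plus_complete:
  assumes "wf_com c" and "wf_com c'"
    and valid: "\<And>s s' t t'. (s, s') \<in> R \<Longrightarrow> (s, t) \<in> den c \<Longrightarrow> (s', t') \<in> den c' \<Longrightarrow> (t, t') \<in> S"
  shows "rhl_plus c c' R S"
proof -
  define Q where "Q = {(t, s'). \<exists>s. (s, s') \<in> R \<and> (s, t) \<in> den c}"
  have "rhl_plus c (Skip 0) R Q"
    using assms by (intro rhl_plus_left_complete) (auto simp: Q_def)
  moreover have "rhl_plus (Skip 0) c' Q S"
    using assms by (intro rhl_plus_right_complete) (auto simp: Q_def)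
  ultimately have "rhl_plus (Seq c (Skip 0)) (Seq (Skip 0) c') R S"
    by (rule rhl_plus.rSeq)
  then show ?thesis
    using kat_equiv_Seq_Skip kat_equiv_Skip_Seq assms(1,2) by (rule rhl_plus.rRewrite)
qed

section \<open>Runs of the automaton of a command\<close>

lemma lab_in_labs: "lab c \<in> labs c"
  by (induction c rule: com_gset_induct) (auto simp: labs_def)

lemma set_lab_list_gcs: "set (lab_list_gcs gcs) = (\<Union>(e, c) \<in> gset gcs. labs c)"
  by (induction gcs rule: gcs.induct[where ?P1.0 = "\<lambda>_. True"]) (auto simp: labs_def)

text \<open>Distinct labels make the label sets of the bodies disjoint, so first-match lookup in the
  list finds the right body.\<close>

lemma gset_distinct:
  assumes "(e, c) \<in> gset gcs" and "distinct (lab_list_gcs gcs)"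
  shows "distinct (lab_list c)"
    and "n \<in> labs c \<Longrightarrow> sub_gcs n gcs = sub n c"
    and "n \<in> labs c \<Longrightarrow> fsuc_gcs n gcs f = fsuc n c f"
  using assms
  by (induction gcs rule: gcs.induct[where ?P1.0 = "\<lambda>_. True"])
    (auto simp: labs_def set_lab_list_gcs)

text \<open>Stated for a part \<open>c\<close> of a fixed \<open>C\<close>, so that all moves stay
  in one automaton while the exit label \<open>f\<close> varies in the induction: it becomes the
  label of the next command in a sequence and the loop label in a loop body.\<close>

lemma den_imp_run:
  fixes c C :: "('v, 'o::int_op, 'p::bool_op) com"
  assumes "\<And>n. n \<in> labs c \<Longrightarrow> n > 0" and "distinct (lab_list c)"
    and "\<And>n. n \<in> labs c \<Longrightarrow> sub n C = sub n c \<and> fsuc n C F = fsuc n c f"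
    and "(s, t) \<in> den c"
  shows "((lab c, s), (f, t)) \<in> (moves (aut C F))\<^sup>*"
  using assms
proof (induction c arbitrary: f s t rule: com_gset_induct)
  case (Skip n)
  \<comment> \<open>A skip has no small step; its move comes from the third disjunct in
    \<open>aut\<close>.\<close>
  then show ?case
    by (intro r_into_rtrancl) (auto simp: labs_def aut_def)
next
  case (Assign n x e)
  \<comment> \<open>The label \<open>- n\<close> of the result is negative, so the second disjunct
    in \<open>aut\<close> passes control to \<open>f\<close>.\<close>
  then have "(Assign n x e, s) \<leadsto> (Skip (- n), t)"
    by (simp add: small_step.Assign)
  then show ?case
    using Assign.prems(1,3)[of n]
    by (intro r_into_rtrancl) (force simp: labs_def aut_def)
next
  case (Havoc n x)
  then have "(Havoc n x, s) \<leadsto> (Skip (- n), t)"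
    by (auto intro: small_step.Havoc)
  then show ?case
    using Havoc.prems(1,3)[of n]
    by (intro r_into_rtrancl) (force simp: labs_def aut_def)
next
  case (Seq c d)
  from Seq.prems(4) obtain u where u: "(s, u) \<in> den c" "(u, t) \<in> den d"
    by auto
  \<comment> \<open>\<open>sub\<close> and \<open>fsuc\<close> search \<open>c\<close> first;
    disjointness makes the labels of \<open>d\<close> resolve in \<open>d\<close>.\<close>
  have labs: "labs (Seq c d) = labs c \<union> labs d" and disj: "labs c \<inter> labs d = {}"
    using Seq.prems(2) by (auto simp: labs_def)
  have "((lab c, s), (lab d, u)) \<in> (moves (aut C F))\<^sup>*"
    using Seq.prems labs u by (intro Seq.IH(1)) auto
  moreover have "((lab d, u), (f, t)) \<in> (moves (aut C F))\<^sup>*"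
    using Seq.prems labs disj u by (intro Seq.IH(2)) (auto simp: disjoint_iff)
  ultimately show ?case
    by simp
next
  case (IfFi n gcs)
  from IfFi.prems(4) obtain e c where ec: "(e, c) \<in> gset gcs" "bval e s" "(s, t) \<in> den c"
    by (auto simp: den_gcs_iff)
  have labs: "labs c \<subseteq> labs (IfFi n gcs)" "n \<notin> labs c" "n \<in> labs (IfFi n gcs)"
    using IfFi.prems(2) ec by (auto simp: labs_def set_lab_list_gcs)
  have dist: "distinct (lab_list_gcs gcs)"
    using IfFi.prems(2) by simp
  have "((n, s), (lab c, s)) \<in> moves (aut C F)"
    using IfFi.prems(1)[of "lab c"] IfFi.prems(3)[of n] labs lab_in_labs[of c]
      small_step.IfFi[OF ec(1,2)]
    by (auto simp: aut_def)
  moreover have "((lab c, s), (f, t)) \<in> (moves (aut C F))\<^sup>*"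
  proof (rule IfFi.IH[OF ec(1) _ gset_distinct(1)[OF ec(1) dist]])
    fix m assume "m \<in> labs c"
    then show "sub m C = sub m c \<and> fsuc m C F = fsuc m c f"
      using IfFi.prems(3)[of m] labs gset_distinct(2,3)[OF ec(1) dist] by auto
  qed (use IfFi.prems labs ec in auto)
  ultimately show ?case
    by simp
next
  case (DoOd n gcs)
  have n: "n \<in> labs (DoOd n gcs)"
    by (simp add: labs_def)
  have dist: "distinct (lab_list_gcs gcs)"
    using DoOd.prems(2) by simp
  \<comment> \<open>The unfolded loop \<open>Seq c (DoOd n gcs)\<close> carries the label
    \<open>lab c\<close>, so control enters the body; the body exits to \<open>n\<close>, back at
    the loop.\<close>
  have iter: "((n, s), (n, t)) \<in> (moves (aut C F))\<^sup>*" if "(s, t) \<in> den_gcs gcs" for s t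
  proof -
    from that obtain e c where ec: "(e, c) \<in> gset gcs" "bval e s" "(s, t) \<in> den c"
      by (auto simp: den_gcs_iff)
    have labs: "labs c \<subseteq> labs (DoOd n gcs)" "n \<notin> labs c"
      using DoOd.prems(2) ec by (auto simp: labs_def set_lab_list_gcs)
    have "((n, s), (lab c, s)) \<in> moves (aut C F)"
      using DoOd.prems(1)[of "lab c"] DoOd.prems(3)[OF n] labs lab_in_labs[of c]
        small_step.DoIter[OF ec(1,2), of n]
      by (fastforce simp: aut_def)
    moreover have "((lab c, s), (n, t)) \<in> (moves (aut C F))\<^sup>*"
    proof (rule DoOd.IH[OF ec(1) _ gset_distinct(1)[OF ec(1) dist]])
      fix m assume "m \<in> labs c"
      then show "sub m C = sub m c \<and> fsuc m C F = fsuc m c n"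
        using DoOd.prems(3)[of m] labs gset_distinct(2,3)[OF ec(1) dist] by auto
    qed (use DoOd.prems labs ec in auto)
    ultimately show ?thesis
      by simp
  qed
  have exit: "\<not> bval (enab gcs) t"
    using DoOd.prems(4) by simp
  have "(s, t) \<in> (den_gcs gcs)\<^sup>*"
    using DoOd.prems(4) by simp
  then have "((n, s), (n, t)) \<in> (moves (aut C F))\<^sup>*"
    by (induction rule: rtrancl_induct) (auto intro: iter rtrancl_trans)
  also have "((n, t), (f, t)) \<in> moves (aut C F)"
    using DoOd.prems(1)[OF n] DoOd.prems(3)[OF n] small_step.DoExit[OF exit, of n]
    by (fastforce simp: aut_def)
  finally show ?case
    by simp
qed

lemma sub_Some_imp_in_labs: "sub n c = Some b \<Longrightarrow> n \<in> labs c"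
  and sub_gcs_Some_imp_in_labs: "sub_gcs n gcs = Some b \<Longrightarrow> n \<in> set (lab_list_gcs gcs)"
  by (induction c and gcs rule: com.induct gcs.induct) (auto simp: labs_def split: if_splits)

text \<open>With \<open>okf c f\<close>, this leaves the final control without outgoing
  moves.\<close>

lemma aut_move_source: "((n, s), q) \<in> moves (aut c f) \<Longrightarrow> n \<in> labs c"
  by (cases q) (auto simp: aut_def dest: sub_Some_imp_in_labs)

section \<open>Adequacy of annotated alignment products\<close>

lemma align_prod_adequate:
  assumes source: "\<And>n s q. ((n, s), q) \<in> moves A \<Longrightarrow> n \<in> ctrl A - {fin A}"
      "\<And>n s q. ((n, s), q) \<in> moves A' \<Longrightarrow> n \<in> ctrl A' - {fin A'}"
    and fin: "fin A \<in> ctrl A" "fin A' \<in> ctrl A'"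
    and live: "live_align A A' L R J"
    and valid: "valid_annotation (align_prod A A' L R J) an"
    and cover: "\<And>i j. (i, j) \<in> ctrl (align_prod A A' L R J) \<Longrightarrow>
      an_states an (i, j) \<subseteq> L \<union> R \<union> J \<union> at_ctrl (fin A) (fin A')"
    and runs: "((n, s), (fin A, t)) \<in> moves A ^^ k" "((n', s'), (fin A', t')) \<in> moves A' ^^ k'"
    and start: "(s, s') \<in> an (n, n')"
  shows "(t, t') \<in> an (fin A, fin A')"
  using runs start
\<comment> \<open>Every product move takes one step off at least one of the two runs.\<close>
proof (induction "k + k'" arbitrary: n s k n' s' k' rule: less_induct)
  case less
  have step: "(u, u') \<in> an (m, m')"
    if "(((n, n'), (s, s')), ((m, m'), (u, u'))) \<in> moves (align_prod A A' L R J)" for m m' u u'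
    using valid less.prems(3) that unfolding valid_annotation_def by blast
  \<comment> \<open>The move \<open>q\<close> given by liveness may differ from that of the run. It
    only excludes \<open>k = 0\<close>, as nothing moves from \<open>fin A\<close>; the move to
    follow is the first one of the run, which a valid annotation also covers.\<close>
  have left: "\<exists>j m u. k = Suc j \<and> ((n, s), (m, u)) \<in> moves A \<and> ((m, u), (fin A, t)) \<in> moves A ^^ j"
    if "((n, s), q) \<in> moves A" for q
  proof (cases k)
    case 0
    then show ?thesis using less.prems(1) source(1)[OF that] by simp
  next
    case (Suc j)
    then show ?thesis using less.prems(1) by (metis relpow_Suc_D2 surj_pair)
  qed
  have right: "\<exists>j m u. k' = Suc j \<and> ((n', s'), (m, u)) \<in> moves A' \<and>
      ((m, u), (fin A', t')) \<in> moves A' ^^ j"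
    if "((n', s'), q) \<in> moves A'" for q
  proof (cases k')
    case 0
    then show ?thesis using less.prems(2) source(2)[OF that] by simp
  next
    case (Suc j)
    then show ?thesis using less.prems(2) by (metis relpow_Suc_D2 surj_pair)
  qed
  \<comment> \<open>\<open>cover\<close> is limited to control points: \<open>n\<close> is the
    source of a move or already final.\<close>
  have "n \<in> ctrl A"
    using less.prems(1) source(1) fin(1)
    by (cases k) (auto simp del: relpow.simps(2) dest!: relpow_Suc_D2)
  moreover have "n' \<in> ctrl A'"
    using less.prems(2) source(2) fin(2)
    by (cases k') (auto simp del: relpow.simps(2) dest!: relpow_Suc_D2)
  ultimately have "((n, n'), (s, s')) \<in> L \<union> R \<union> J \<union> at_ctrl (fin A) (fin A')"
    using cover[of n n'] less.prems(3) by (auto simp: align_prod_def an_states_def)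
  then consider (L) "((n, n'), (s, s')) \<in> L" | (R) "((n, n'), (s, s')) \<in> R"
    | (J) "((n, n'), (s, s')) \<in> J" | (final) "n = fin A" "n' = fin A'"
    by (auto simp: at_ctrl_def)
  then show ?case
  proof cases
    case L
    with live obtain q where "((n, s), q) \<in> moves A"
      unfolding live_align_def by blast
    with left obtain j m u where j: "k = Suc j" "((n, s), (m, u)) \<in> moves A"
      "((m, u), (fin A, t)) \<in> moves A ^^ j" by blast
    have "(u, s') \<in> an (m, n')"
      using L j(2) by (intro step) (simp add: align_prod_def)
    then show ?thesis
      using less.hyps[OF _ j(3) less.prems(2)] j(1) by simp
  next
    case R
    with live obtain q where "((n', s'), q) \<in> moves A'"
      unfolding live_align_def by blast
    with right obtain j m u where j: "k' = Suc j" "((n', s'), (m, u)) \<in> moves A'"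
      "((m, u), (fin A', t')) \<in> moves A' ^^ j" by blast
    have "(s, u) \<in> an (n, m)"
      using R j(2) by (intro step) (simp add: align_prod_def)
    then show ?thesis
      using less.hyps[OF _ less.prems(1) j(3)] j(1) by simp
  next
    case J
    with live obtain q q' where "((n, s), q) \<in> moves A" "((n', s'), q') \<in> moves A'"
      unfolding live_align_def by blast
    with left right obtain j m u j' m' u' where
      j: "k = Suc j" "((n, s), (m, u)) \<in> moves A" "((m, u), (fin A, t)) \<in> moves A ^^ j" and
      j': "k' = Suc j'" "((n', s'), (m', u')) \<in> moves A'"
        "((m', u'), (fin A', t')) \<in> moves A' ^^ j'" by metis
    have "(u, u') \<in> an (m, m')"
      using J j(2) j'(2) by (intro step) (simp add: align_prod_def)
    then show ?thesis
      using less.hyps[OF _ j(3) j'(3)] j(1) j'(1) by simp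
  next
    case final
    \<comment> \<open>Final controls have no moves, so both runs are empty and the stores are the
      given ones.\<close>
    then have "k = 0"
      using less.prems(1) source(1) by (cases k) (auto simp del: relpow.simps(2) dest!: relpow_Suc_D2)
    moreover have "k' = 0"
      using final less.prems(2) source(2) by (cases k') (auto simp del: relpow.simps(2) dest!: relpow_Suc_D2)
    ultimately show ?thesis
      using less.prems by simp
  qed
qed

theorem theorem6p1:
  fixes c c' :: "('v, 'o::int_op, 'p::bool_op) com"
    and f f' :: int
    and L R J :: "(int, int, 'v store, 'v store) pstates"
    and an :: "int \<times> int \<Rightarrow> 'v srel"
    and S T :: "'v srel"
  assumes "wf_com c" and "wf_com c'"
    and "okf c f" and "okf c' f'"
    and "live_align (aut c f) (aut c' f') L R J"
    and "annotation (align_prod (aut c f) (aut c' f') L R J) S T an"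
    and "valid_annotation (align_prod (aut c f) (aut c' f') L R J) an"
    and "\<And>i j. (i, j) \<in> ctrl (align_prod (aut c f) (aut c' f') L R J) \<Longrightarrow>
           an_states an (i, j) \<subseteq> L \<union> R \<union> J \<union> at_ctrl f f'"
  shows "rhl_plus c c' S T"
proof (rule rhl_plus_complete)
  fix s s' t t'
  assume "(s, s') \<in> S" and den: "(s, t) \<in> den c" "(s', t') \<in> den c'"
  have S: "an (lab c, lab c') = S" and T: "an (f, f') = T"
    using assms(6) by (auto simp: annotation_def align_prod_def aut_def)
  have fin: "fin (aut d g) = g" "ctrl (aut d g) = labs d \<union> {g}"
    for d :: "('v, 'o, 'p) com" and g
    by (simp_all add: aut_def)
  \<comment> \<open>Instance with \<open>C = c\<close> and \<open>F = f\<close>, where the lookups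
    agree trivially.\<close>
  have "((lab c, s), (f, t)) \<in> (moves (aut c f))\<^sup>*"
    using assms(3) den(1) by (intro den_imp_run) (auto simp: okf_def)
  then obtain k where k: "((lab c, s), (fin (aut c f), t)) \<in> moves (aut c f) ^^ k"
    using rtrancl_imp_relpow fin(1) by metis
  have "((lab c', s'), (f', t')) \<in> (moves (aut c' f'))\<^sup>*"
    using assms(4) den(2) by (intro den_imp_run) (auto simp: okf_def)
  then obtain k' where k': "((lab c', s'), (fin (aut c' f'), t')) \<in> moves (aut c' f') ^^ k'"
    using rtrancl_imp_relpow fin(1) by metis
  have "(t, t') \<in> an (fin (aut c f), fin (aut c' f'))"
  proof (rule align_prod_adequate[OF _ _ _ _ assms(5,7) _ k k'])
    show "n \<in> ctrl (aut c f) - {fin (aut c f)}" if "((n, s), q) \<in> moves (aut c f)" for n s q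
      using aut_move_source[OF that] assms(3) by (auto simp: fin okf_def)
    show "n \<in> ctrl (aut c' f') - {fin (aut c' f')}" if "((n, s), q) \<in> moves (aut c' f')" for n s q
      using aut_move_source[OF that] assms(4) by (auto simp: fin okf_def)
  qed (use assms(8) S \<open>(s, s') \<in> S\<close> in \<open>simp_all add: fin\<close>)
  then show "(t, t') \<in> T"
    by (simp add: fin T)
qed (use assms in simp_all)

end
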